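(* Let $E$ be a sequentially complete Hausdorff locally convex space and $(\gamma_n)_n$ a sequence of Lusin-measurable functions $\gamma_n:[0,1]\to E$. Assume that for each $\varepsilon>0$ there exists a compact subset $M_\varepsilon$ of $[0,1]$ such that $\lambda([0,1]\setminus M_\varepsilon)<\varepsilon$ and $(\gamma_n|_{M_\varepsilon})_n$ is a uniformly Cauchy sequence in $M_\varepsilon$. Then the pointwise limit of $(\gamma_n)_n$ exists almost everywhere. Moreover, the function \[ \gamma:[0,1]\to E,\quad \gamma(t)=\begin{cases}\lim_{n\to\infty}\gamma_n(t), & \text{if the limit exists},\\ 0, & \text{if not},\end{cases} \] is Lusin-measurable.
   Context: All locally convex spaces are real. $\lambda$ is Lebesgue measure on $[0,1]$. A function $\gamma:[0,1]\to E$ is Lusin-measurable if for each $\varepsilon>0$ there is a compact $K_\varepsilon\subseteq[0,1]$ with $\lambda([0,1]\setminus K_\varepsilon)\leq\varepsilon$ and $\gamma|_{K_\varepsilon}$ continuous. A sequence $(\gamma_n)_n$ is uniformly Cauchy in $M\subseteq[0,1]$ if for each $\varepsilon>0$ and each continuous seminorm $q$ on $E$ there is $n_{\varepsilon,q}\in\mathbb{N}$ such that $\sup_{t\in M}q(\gamma_m(t)-\gamma_n(t))<\varepsilon$ for all $n,m\geq n_{\varepsilon,q}$. *)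

theory Defs
  imports "HOL-Analysis.Analysis"
begin

text \<open>Real topological vector spaces, not assumed to be Hausdorff. Continuity of negation, which
  \<^class>\<open>topological_ab_group_add\<close> requires, follows from that of scalar multiplication.\<close>

class topological_real_vector = real_vector + topological_ab_group_add +
  assumes tendsto_scaleR_Pair:
    "LIM x (nhds a \<times>\<^sub>F nhds b). fst x *\<^sub>R snd x :> nhds (a *\<^sub>R b)"

text \<open>The second conjunct unfolds \<^const>\<open>convex\<close>, whose sort constraint rules it out in a class
  specification.\<close>

class locally_convex_space = topological_real_vector +
  assumes locally_convex_unfolded:
    "open U \<Longrightarrow> 0 \<in> U \<Longrightarrow>
      \<exists>V\<subseteq>U. (\<forall>x\<in>V. \<forall>y\<in>V. \<forall>u\<ge>0. \<forall>v\<ge>0. u + v = 1 \<longrightarrow> u *\<^sub>R x + v *\<^sub>R y \<in> V) \<and>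
        eventually (\<lambda>x. x \<in> V) (nhds 0)"

lemma locally_convex:
  fixes U :: "'a::locally_convex_space set"
  assumes "open U" "0 \<in> U"
  shows "\<exists>V\<subseteq>U. convex V \<and> eventually (\<lambda>x. x \<in> V) (nhds 0)"
  using locally_convex_unfolded[OF assms] by (simp add: convex_def)

instance real_normed_vector \<subseteq> locally_convex_space
proof
  fix a :: real and b :: 'a
  show "LIM x (nhds a \<times>\<^sub>F nhds b). fst x *\<^sub>R snd x :> nhds (a *\<^sub>R b)"
    by (intro tendsto_scaleR filterlim_fst filterlim_snd)
next
  fix U :: "'a set"
  assume "open U" "0 \<in> U"
  then obtain e where "e > 0" "ball 0 e \<subseteq> U"
    by (meson openE)
  moreover from \<open>e > 0\<close> have "eventually (\<lambda>x. x \<in> ball 0 e) (nhds (0::'a))"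
    by (intro eventually_nhds_in_open) auto
  ultimately show "\<exists>V\<subseteq>U. (\<forall>x\<in>V. \<forall>y\<in>V. \<forall>u\<ge>0. \<forall>v\<ge>0. u + v = 1 \<longrightarrow> u *\<^sub>R x + v *\<^sub>R y \<in> V) \<and>
      eventually (\<lambda>x. x \<in> V) (nhds 0)"
    using convex_ball[of "0::'a" e] unfolding convex_def by blast
qed

text \<open>The library constant \<^const>\<open>Cauchy\<close> needs a uniformity attached to the type, whereas here the
  uniform structure is the one given by the 0-neighbourhoods of the vector topology.\<close>

definition lcs_Cauchy :: "(nat \<Rightarrow> 'a::locally_convex_space) \<Rightarrow> bool" where
  "lcs_Cauchy x \<longleftrightarrow>
     (\<forall>U. open U \<and> 0 \<in> U \<longrightarrow> (\<exists>N. \<forall>m\<ge>N. \<forall>n\<ge>N. x m - x n \<in> U))"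

definition sequentially_complete :: "'a::locally_convex_space set \<Rightarrow> bool" where
  "sequentially_complete S \<longleftrightarrow>
     (\<forall>x. range x \<subseteq> S \<and> lcs_Cauchy x \<longrightarrow> (\<exists>l\<in>S. x \<longlonglongrightarrow> l))"

definition seminorm :: "('a::real_vector \<Rightarrow> real) \<Rightarrow> bool" where
  "seminorm q \<longleftrightarrow>
     (\<forall>x. 0 \<le> q x) \<and>
     (\<forall>x y. q (x + y) \<le> q x + q y) \<and>
     (\<forall>c x. q (c *\<^sub>R x) = \<bar>c\<bar> * q x)"

text \<open>The supremum is taken in \<open>[0, \<infinity>]\<close>, so that it is \<open>\<infinity>\<close> for unbounded and \<open>0\<close> for empty
  families.\<close>

definition uniformly_Cauchy_in ::
    "real set \<Rightarrow> (nat \<Rightarrow> real \<Rightarrow> 'a::locally_convex_space) \<Rightarrow> bool" where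
  "uniformly_Cauchy_in M \<gamma> \<longleftrightarrow>
     (\<forall>\<epsilon>>0. \<forall>q. seminorm q \<and> continuous_on UNIV q \<longrightarrow>
        (\<exists>N. \<forall>m\<ge>N. \<forall>n\<ge>N. (SUP t\<in>M. ennreal (q (\<gamma> m t - \<gamma> n t))) < ennreal \<epsilon>))"

text \<open>Functions on \<open>[0,1]\<close> are total functions on the reals of which only the values on \<open>[0,1]\<close>
  matter.\<close>

definition lusin_measurable :: "(real \<Rightarrow> 'a::topological_space) \<Rightarrow> bool" where
  "lusin_measurable \<gamma> \<longleftrightarrow>
     (\<forall>\<epsilon>>0. \<exists>K\<subseteq>{0..1}. compact K \<and> measure lebesgue ({0..1} - K) \<le> \<epsilon> \<and> continuous_on K \<gamma>)"

end

theory Submission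
  imports Defs
begin

text \<open>Minkowski functionals turn the seminorm condition into uniform smallness with respect to
  0-neighbourhoods, so sequential completeness yields pointwise limits on each \<open>M\<^sub>\<epsilon>\<close>, and these sets
  exhaust \<open>[0,1]\<close> up to a null set. Intersecting \<open>M\<^sub>\<epsilon>\<close> with compact sets \<open>K\<^sub>n\<close> on which \<open>\<gamma>\<^sub>n\<close> is
  continuous and whose complements have measures summing to at most \<open>\<epsilon>\<close>, one obtains a large
  compact set on which the limit is a uniform limit of continuous functions.\<close>

section \<open>Minkowski functionals\<close>

text \<open>The gauge of \<open>W\<close>, with dilation moved onto the point. The infimum is
  meaningful only when some dilate of \<open>W\<close> contains \<open>x\<close>, hence the
  absorption hypotheses below.\<close>

definition minkowski :: "'a::real_vector set \<Rightarrow> 'a \<Rightarrow> real" where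
  "minkowski W x = Inf {t. t > 0 \<and> inverse t *\<^sub>R x \<in> W}"

lemma minkowski_le:
  assumes "t > 0" "inverse t *\<^sub>R x \<in> W"
  shows "minkowski W x \<le> t"
  unfolding minkowski_def
  by (rule cInf_lower) (use assms in \<open>auto intro: bdd_belowI[of _ 0]\<close>)

lemma le_minkowski:
  assumes "\<exists>t>0. inverse t *\<^sub>R x \<in> W"
    and "\<And>t. t > 0 \<Longrightarrow> inverse t *\<^sub>R x \<in> W \<Longrightarrow> a \<le> t"
  shows "a \<le> minkowski W x"
  unfolding minkowski_def
  by (rule cInf_greatest) (use assms in auto)

text \<open>If \<open>t\<close> is admissible for \<open>x\<close>, then
  \<open>\<bar>c\<bar> * t\<close> is admissible for \<open>c *\<^sub>R x\<close> up to a sign,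
  which symmetry of \<open>W\<close> absorbs. One inequality is enough: the reverse one follows by
  applying it to \<open>inverse c\<close>.\<close>

lemma minkowski_scaleR_le:
  assumes absorbing: "\<And>x. \<exists>t>0. inverse t *\<^sub>R x \<in> W"
    and symmetric: "\<And>x. x \<in> W \<Longrightarrow> - x \<in> W"
    and "c \<noteq> 0"
  shows "minkowski W (c *\<^sub>R x) \<le> \<bar>c\<bar> * minkowski W x"
proof -
  have "minkowski W (c *\<^sub>R x) / \<bar>c\<bar> \<le> minkowski W x"
  proof (rule le_minkowski[OF absorbing])
    fix t :: real
    assume t: "t > 0" "inverse t *\<^sub>R x \<in> W"
    have "inverse (\<bar>c\<bar> * t) *\<^sub>R c *\<^sub>R x = inverse t *\<^sub>R x \<or>
        inverse (\<bar>c\<bar> * t) *\<^sub>R c *\<^sub>R x = - (inverse t *\<^sub>R x)"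
      using \<open>c \<noteq> 0\<close> t(1) by (cases "c > 0") (auto simp: divide_simps)
    with t(2) symmetric have "inverse (\<bar>c\<bar> * t) *\<^sub>R c *\<^sub>R x \<in> W"
      by metis
    with t(1) \<open>c \<noteq> 0\<close> have "minkowski W (c *\<^sub>R x) \<le> \<bar>c\<bar> * t"
      by (intro minkowski_le) auto
    then show "minkowski W (c *\<^sub>R x) / \<bar>c\<bar> \<le> t"
      using \<open>c \<noteq> 0\<close> by (simp add: field_simps)
  qed
  then show ?thesis
    using \<open>c \<noteq> 0\<close> by (simp add: field_simps)
qed

text \<open>With weights \<open>s / (s + t)\<close> and \<open>t / (s + t)\<close>, the convex
  combination of \<open>x / s\<close> and \<open>y / t\<close> is \<open>(x + y) / (s + t)\<close>.
  The two infima are taken one after the other, so each goal is rearranged into a lower bound for a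
  single gauge.\<close>

lemma minkowski_triangle:
  assumes absorbing: "\<And>x. \<exists>t>0. inverse t *\<^sub>R x \<in> W" and "convex W"
  shows "minkowski W (x + y) \<le> minkowski W x + minkowski W y"
proof -
  have "minkowski W (x + y) - minkowski W y \<le> minkowski W x"
  proof (rule le_minkowski[OF absorbing])
    fix s :: real
    assume s: "s > 0" "inverse s *\<^sub>R x \<in> W"
    have "minkowski W (x + y) - s \<le> minkowski W y"
    proof (rule le_minkowski[OF absorbing])
      fix t :: real
      assume t: "t > 0" "inverse t *\<^sub>R y \<in> W"
      have "(s / (s + t)) *\<^sub>R (inverse s *\<^sub>R x) + (t / (s + t)) *\<^sub>R (inverse t *\<^sub>R y) \<in> W"
        using \<open>convex W\<close> s t by (intro convexD) (auto simp: add_divide_distrib[symmetric])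
      moreover have "(s / (s + t)) *\<^sub>R (inverse s *\<^sub>R x) + (t / (s + t)) *\<^sub>R (inverse t *\<^sub>R y) =
          inverse (s + t) *\<^sub>R (x + y)"
        using s t by (simp add: scaleR_add_right field_simps)
      ultimately have "minkowski W (x + y) \<le> s + t"
        using s t by (intro minkowski_le) auto
      then show "minkowski W (x + y) - s \<le> t" by simp
    qed
    then show "minkowski W (x + y) - minkowski W y \<le> s" by simp
  qed
  then show ?thesis by simp
qed

lemma seminorm_minkowski:
  assumes absorbing: "\<And>x. \<exists>t>0. inverse t *\<^sub>R x \<in> W"
    and symmetric: "\<And>x. x \<in> W \<Longrightarrow> - x \<in> W" and "convex W"
  shows "seminorm (minkowski W)"
  unfolding seminorm_def
proof (intro conjI allI)
  show nonneg: "0 \<le> minkowski W x" for x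
    by (rule le_minkowski[OF absorbing]) simp
  show "minkowski W (x + y) \<le> minkowski W x + minkowski W y" for x y
    by (rule minkowski_triangle[OF absorbing \<open>convex W\<close>])
  show "minkowski W (c *\<^sub>R x) = \<bar>c\<bar> * minkowski W x" for c x
  proof (cases "c = 0")
    case True
    obtain t :: real where "t > 0" "inverse t *\<^sub>R (0::'a) \<in> W"
      using absorbing by blast
    \<comment> \<open>Scaling fixes the zero vector, so absorption puts it into \<open>W\<close> and
      every positive \<open>e\<close> is admissible for it.\<close>
    then have "minkowski W 0 \<le> e" if "e > 0" for e
      using that by (intro minkowski_le) auto
    then have "minkowski W 0 \<le> 0"
      by (rule dense_ge)
    with nonneg[of 0] True show ?thesis by simp
  next
    case False
    have "minkowski W x \<le> \<bar>inverse c\<bar> * minkowski W (c *\<^sub>R x)"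
      using minkowski_scaleR_le[of W "inverse c" "c *\<^sub>R x", OF absorbing symmetric] False by simp
    then have "\<bar>c\<bar> * minkowski W x \<le> minkowski W (c *\<^sub>R x)"
      using False by (simp add: field_simps)
    with minkowski_scaleR_le[of W c x, OF absorbing symmetric False] show ?thesis by simp
  qed
qed

text \<open>Some admissible \<open>t\<close> is below 1, and then \<open>x\<close> is the convex
  combination of \<open>inverse t *\<^sub>R x\<close> and 0 with weights \<open>t\<close> and
  \<open>1 - t\<close>.\<close>

lemma minkowski_less_1_imp_mem:
  assumes absorbing: "\<And>x. \<exists>t>0. inverse t *\<^sub>R x \<in> W" and "convex W"
    and less: "minkowski W x < 1"
  shows "x \<in> W"
proof -
  obtain t where t: "t > 0" "inverse t *\<^sub>R x \<in> W" "t < 1"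
    using less le_minkowski[OF absorbing, of x 1] by (meson linorder_not_le)
  have "0 \<in> W"
    using absorbing[of 0] by auto
  with t \<open>convex W\<close> have "t *\<^sub>R (inverse t *\<^sub>R x) + (1 - t) *\<^sub>R 0 \<in> W"
    by (intro convexD) auto
  with t show ?thesis by simp
qed

section \<open>Locally convex spaces\<close>

lemma tendsto_scaleR_topological:
  fixes g :: "'b \<Rightarrow> 'a::topological_real_vector"
  assumes "(f \<longlongrightarrow> a) F" "(g \<longlongrightarrow> b) F"
  shows "((\<lambda>x. f x *\<^sub>R g x) \<longlongrightarrow> a *\<^sub>R b) F"
  using filterlim_compose[OF tendsto_scaleR_Pair filterlim_Pair[OF assms]] by simp

text \<open>For fixed \<open>x\<close>, the vectors \<open>inverse t *\<^sub>R x\<close> tend to 0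
  as \<open>t\<close> grows, by continuity of scalar multiplication.\<close>

lemma neighbourhood_absorbing:
  fixes W :: "'a::topological_real_vector set"
  assumes "\<forall>\<^sub>F x in nhds 0. x \<in> W"
  shows "\<exists>t>0. inverse t *\<^sub>R x \<in> W"
proof -
  have "((\<lambda>t. inverse t *\<^sub>R x) \<longlongrightarrow> 0 *\<^sub>R x) (at_top :: real filter)"
    by (intro tendsto_scaleR_topological tendsto_inverse_0_at_top filterlim_ident tendsto_const)
  then have "\<forall>\<^sub>F t::real in at_top. inverse t *\<^sub>R x \<in> W"
    using assms by (auto intro: eventually_compose_filterlim)
  then have "\<forall>\<^sub>F t::real in at_top. t > 0 \<and> inverse t *\<^sub>R x \<in> W"
    using eventually_gt_at_top eventually_conj by blast
  then show ?thesis
    by (auto dest: eventually_happens)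
qed

lemma continuous_on_minkowski:
  fixes W :: "'a::topological_real_vector set"
  assumes W: "\<forall>\<^sub>F x in nhds 0. x \<in> W"
    and symmetric: "\<And>x. x \<in> W \<Longrightarrow> - x \<in> W" and "convex W"
  shows "continuous_on UNIV (minkowski W)"
  unfolding continuous_on_def
proof (intro ballI tendstoI)
  fix x :: 'a and e :: real
  assume "e > 0"
  \<comment> \<open>Membership in \<open>W\<close> bounds the gauge only non-strictly, so
    \<open>e / 2\<close> is used to reach a strict bound by \<open>e\<close>.\<close>
  have "((\<lambda>y. inverse (e / 2) *\<^sub>R (y - x)) \<longlongrightarrow> inverse (e / 2) *\<^sub>R (x - x)) (at x)"
    by (intro tendsto_scaleR_topological tendsto_intros)
  then have "\<forall>\<^sub>F y in at x. inverse (e / 2) *\<^sub>R (y - x) \<in> W"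
    using W by (auto intro: eventually_compose_filterlim)
  then show "\<forall>\<^sub>F y in at x. dist (minkowski W y) (minkowski W x) < e"
  proof eventually_elim
    case (elim y)
    have "inverse (e / 2) *\<^sub>R (x - y) \<in> W"
      using symmetric[OF elim] by (metis minus_diff_eq scaleR_minus_right)
    then have "minkowski W (x - y) \<le> e / 2" "minkowski W (y - x) \<le> e / 2"
      using elim \<open>e > 0\<close> by (intro minkowski_le; simp)+
    moreover have "minkowski W x \<le> minkowski W (x - y) + minkowski W y"
      "minkowski W y \<le> minkowski W (y - x) + minkowski W x"
      using minkowski_triangle[OF neighbourhood_absorbing[OF W] \<open>convex W\<close>, of "x - y" y]
        minkowski_triangle[OF neighbourhood_absorbing[OF W] \<open>convex W\<close>, of "y - x" x] by auto
    ultimately show ?case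
      using \<open>e > 0\<close> by (simp add: dist_real_def)
  qed
qed

text \<open>The gauge of a symmetric convex 0-neighbourhood inside \<open>U\<close> is such a
  seminorm. This is where local convexity enters.\<close>

lemma continuous_seminorm_ball_subset:
  fixes U :: "'a::locally_convex_space set"
  assumes "open U" "0 \<in> U"
  obtains q where "seminorm q" "continuous_on UNIV q" "\<And>x. q x < 1 \<Longrightarrow> x \<in> U"
proof -
  obtain V where V: "V \<subseteq> U" "convex V" "\<forall>\<^sub>F x in nhds 0. x \<in> V"
    using locally_convex[OF assms] by blast
  \<comment> \<open>Intersecting with the reflection makes \<open>V\<close> symmetric and keeps it a
    convex 0-neighbourhood.\<close>
  define W where "W = V \<inter> uminus ` V"
  have mem_W: "x \<in> W \<longleftrightarrow> x \<in> V \<and> - x \<in> V" for x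
    by (auto simp: W_def image_iff) (metis minus_minus)
  have "convex W"
    unfolding W_def by (intro convex_Int convex_negations V)
  have symmetric: "- x \<in> W" if "x \<in> W" for x
    using that by (simp add: mem_W)
  have "(uminus \<longlongrightarrow> - 0) (nhds (0::'a))"
    by (intro tendsto_minus filterlim_ident)
  then have "\<forall>\<^sub>F x in nhds 0. - x \<in> V"
    using V(3) by (auto intro: eventually_compose_filterlim)
  with V(3) have W: "\<forall>\<^sub>F x in nhds 0. x \<in> W"
    by eventually_elim (simp add: mem_W)
  show ?thesis
  proof
    show "seminorm (minkowski W)"
      by (rule seminorm_minkowski[OF neighbourhood_absorbing[OF W] symmetric \<open>convex W\<close>])
    show "continuous_on UNIV (minkowski W)"
      by (rule continuous_on_minkowski[OF W symmetric \<open>convex W\<close>])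
    show "x \<in> U" if "minkowski W x < 1" for x
      using minkowski_less_1_imp_mem[OF neighbourhood_absorbing[OF W] \<open>convex W\<close> that] V(1)
      by (auto simp: mem_W)
  qed
qed

section \<open>Uniformly Cauchy sequences and their limits\<close>

lemma uniformly_Cauchy_in_neighbourhood:
  fixes \<gamma> :: "nat \<Rightarrow> real \<Rightarrow> 'a::locally_convex_space"
  assumes "uniformly_Cauchy_in M \<gamma>" "open U" "0 \<in> U"
  shows "\<exists>N. \<forall>m\<ge>N. \<forall>n\<ge>N. \<forall>t\<in>M. \<gamma> m t - \<gamma> n t \<in> U"
proof -
  obtain q where q: "seminorm q" "continuous_on UNIV q" "\<And>x. q x < 1 \<Longrightarrow> x \<in> U"
    using continuous_seminorm_ball_subset[OF assms(2,3)] by blast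
  obtain N where N: "\<forall>m\<ge>N. \<forall>n\<ge>N. (SUP t\<in>M. ennreal (q (\<gamma> m t - \<gamma> n t))) < ennreal 1"
    using assms(1) q(1,2) unfolding uniformly_Cauchy_in_def by (meson zero_less_one)
  have "\<gamma> m t - \<gamma> n t \<in> U" if "m \<ge> N" "n \<ge> N" "t \<in> M" for m n t
  proof (rule q(3))
    have "ennreal (q (\<gamma> m t - \<gamma> n t)) < ennreal 1"
      using N that by (meson SUP_upper le_less_trans)
    \<comment> \<open>Passing back from \<open>ennreal\<close> uses that \<open>q\<close> is
      nonnegative.\<close>
    then show "q (\<gamma> m t - \<gamma> n t) < 1"
      using q(1) by (subst (asm) ennreal_less_iff) (auto simp: seminorm_def)
  qed
  then show ?thesis by blast
qed

lemma uniformly_Cauchy_in_convergent: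
  fixes \<gamma> :: "nat \<Rightarrow> real \<Rightarrow> 'a::locally_convex_space"
  assumes "sequentially_complete (UNIV :: 'a set)" "uniformly_Cauchy_in M \<gamma>" "t \<in> M"
  shows "convergent (\<lambda>n. \<gamma> n t)"
proof -
  have "lcs_Cauchy (\<lambda>n. \<gamma> n t)"
    unfolding lcs_Cauchy_def
    using uniformly_Cauchy_in_neighbourhood[OF assms(2)] assms(3) by meson
  with assms(1) show ?thesis
    unfolding sequentially_complete_def convergent_def by auto
qed

text \<open>Continuity of subtraction at the origin. It replaces the halving of \<epsilon> in the
  limit arguments below.\<close>

lemma open_diff_subset:
  fixes U :: "'a::topological_ab_group_add set"
  assumes "open U" "0 \<in> U"
  obtains W where "open W" "0 \<in> W" "\<And>x y. x \<in> W \<Longrightarrow> y \<in> W \<Longrightarrow> x - y \<in> U"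
proof -
  have "((\<lambda>x::'a \<times> 'a. fst x - snd x) \<longlongrightarrow> 0 - 0) (nhds 0 \<times>\<^sub>F nhds 0)"
    by (intro tendsto_diff filterlim_fst filterlim_snd)
  then have "\<forall>\<^sub>F x::'a \<times> 'a in nhds 0 \<times>\<^sub>F nhds 0. fst x - snd x \<in> U"
    using assms by (auto dest: topological_tendstoD)
  then obtain P Q where PQ: "eventually P (nhds (0::'a))" "eventually Q (nhds (0::'a))"
    "\<And>x y. P x \<Longrightarrow> Q y \<Longrightarrow> x - y \<in> U"
    by (auto simp: eventually_prod_filter)
  obtain A where A: "open A" "0 \<in> A" "\<forall>x\<in>A. P x"
    using PQ(1) by (auto simp: eventually_nhds)
  obtain B where B: "open B" "0 \<in> B" "\<forall>x\<in>B. Q x"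
    using PQ(2) by (auto simp: eventually_nhds)
  show ?thesis
    by (rule that[of "A \<inter> B"]) (use A B PQ(3) in auto)
qed

lemma tendsto_iff_diff:
  fixes f :: "'b \<Rightarrow> 'a::topological_ab_group_add"
  shows "(f \<longlongrightarrow> l) F \<longleftrightarrow> ((\<lambda>x. f x - l) \<longlongrightarrow> 0) F"
proof
  assume "(f \<longlongrightarrow> l) F"
  from tendsto_diff[OF this tendsto_const[of l]] show "((\<lambda>x. f x - l) \<longlongrightarrow> 0) F" by simp
next
  assume "((\<lambda>x. f x - l) \<longlongrightarrow> 0) F"
  from tendsto_add[OF this tendsto_const[of l]] show "(f \<longlongrightarrow> l) F" by simp
qed

text \<open>Write \<open>g t - \<gamma> N t\<close> as
  \<open>(\<gamma> n t - \<gamma> N t) - (\<gamma> n t - g t)\<close>. The auxiliary index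
  \<open>n\<close> may depend on \<open>t\<close>, while \<open>N\<close> is uniform on
  \<open>M\<close>.\<close>

lemma uniformly_Cauchy_in_limit_neighbourhood:
  fixes \<gamma> :: "nat \<Rightarrow> real \<Rightarrow> 'a::locally_convex_space"
  assumes "uniformly_Cauchy_in M \<gamma>" and lim: "\<And>t. t \<in> M \<Longrightarrow> (\<lambda>n. \<gamma> n t) \<longlonglongrightarrow> g t"
    and "open U" "0 \<in> U"
  shows "\<exists>m. \<forall>t\<in>M. g t - \<gamma> m t \<in> U"
proof -
  obtain W where W: "open W" "0 \<in> W" "\<And>x y. x \<in> W \<Longrightarrow> y \<in> W \<Longrightarrow> x - y \<in> U"
    using open_diff_subset[OF assms(3,4)] by blast
  obtain N where N: "\<forall>m\<ge>N. \<forall>n\<ge>N. \<forall>t\<in>M. \<gamma> m t - \<gamma> n t \<in> W"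
    using uniformly_Cauchy_in_neighbourhood[OF assms(1) W(1,2)] by blast
  have "g t - \<gamma> N t \<in> U" if "t \<in> M" for t
  proof -
    have "\<forall>\<^sub>F n in sequentially. \<gamma> n t - g t \<in> W"
      using lim[OF that] W(1,2) unfolding tendsto_iff_diff[of _ "g t"]
      by (auto dest: topological_tendstoD)
    with eventually_ge_at_top[of N] have "\<forall>\<^sub>F n in sequentially. n \<ge> N \<and> \<gamma> n t - g t \<in> W"
      by (rule eventually_conj)
    then obtain n where "n \<ge> N" "\<gamma> n t - g t \<in> W"
      by (auto dest: eventually_happens)
    with N that W(3)[of "\<gamma> n t - \<gamma> N t" "\<gamma> n t - g t"] show ?thesis by simp
  qed
  then show ?thesis by blast
qed

text \<open>The three-epsilon argument with nested neighbourhoods: \<open>g s - g t\<close> is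
  \<open>(g s - \<gamma> m s) - (\<gamma> m t - \<gamma> m s) - (g t - \<gamma> m
  t)\<close>.\<close>

lemma uniformly_Cauchy_in_limit_continuous_on:
  fixes \<gamma> :: "nat \<Rightarrow> real \<Rightarrow> 'a::locally_convex_space"
  assumes "uniformly_Cauchy_in M \<gamma>" and lim: "\<And>t. t \<in> M \<Longrightarrow> (\<lambda>n. \<gamma> n t) \<longlonglongrightarrow> g t"
    and "S \<subseteq> M" and cont: "\<And>n. continuous_on S (\<gamma> n)"
  shows "continuous_on S g"
  unfolding continuous_on_def
proof
  fix t
  assume "t \<in> S"
  have "((\<lambda>s. g s - g t) \<longlongrightarrow> 0) (at t within S)"
  proof (rule topological_tendstoI)
    fix U :: "'a set"
    assume "open U" "0 \<in> U"
    then obtain V where V: "open V" "0 \<in> V" "\<And>x y. x \<in> V \<Longrightarrow> y \<in> V \<Longrightarrow> x - y \<in> U"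
      using open_diff_subset by blast
    obtain W where W: "open W" "0 \<in> W" "\<And>x y. x \<in> W \<Longrightarrow> y \<in> W \<Longrightarrow> x - y \<in> V"
      using open_diff_subset[OF V(1,2)] by blast
    \<comment> \<open>The approximation error must lie in \<open>W\<close> at \<open>s\<close>, for
      the inner difference, and in \<open>V\<close> at \<open>t\<close>, for the outer one.\<close>
    obtain m where m: "\<forall>t\<in>M. g t - \<gamma> m t \<in> V \<inter> W"
      using uniformly_Cauchy_in_limit_neighbourhood[OF assms(1) lim, of "V \<inter> W"] V W by auto
    have "((\<lambda>s. \<gamma> m s - \<gamma> m t) \<longlongrightarrow> 0) (at t within S)"
      using cont[of m] \<open>t \<in> S\<close> by (simp add: continuous_on_def tendsto_iff_diff[symmetric])
    \<comment> \<open>The sign is flipped to fit the decomposition, since \<open>W\<close> need not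
      be symmetric.\<close>
    then have "((\<lambda>s. \<gamma> m t - \<gamma> m s) \<longlongrightarrow> 0) (at t within S)"
      using tendsto_minus by fastforce
    then have "\<forall>\<^sub>F s in at t within S. \<gamma> m t - \<gamma> m s \<in> W"
      using W(1,2) by (auto dest: topological_tendstoD)
    moreover have "\<forall>\<^sub>F s in at t within S. s \<in> S"
      by (simp add: eventually_at_filter)
    ultimately show "\<forall>\<^sub>F s in at t within S. g s - g t \<in> U"
    proof eventually_elim
      case (elim s)
      have "(g s - \<gamma> m s) - (\<gamma> m t - \<gamma> m s) \<in> V"
        using elim m \<open>S \<subseteq> M\<close> by (intro W(3)) auto
      then have "(g s - \<gamma> m t) - (g t - \<gamma> m t) \<in> U"
        using m \<open>t \<in> S\<close> \<open>S \<subseteq> M\<close> by (intro V(3)) auto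
      then show ?case by simp
    qed
  qed
  then show "(g \<longlongrightarrow> g t) (at t within S)"
    by (simp add: tendsto_iff_diff[symmetric])
qed

section \<open>Measure-theoretic part\<close>

text \<open>Allow the \<open>n\<close>-th function an exceptional set of measure at most
  \<open>\<epsilon> * (1/2) ^ Suc n\<close> and intersect all the compact sets; the allowances add
  up to \<epsilon>.\<close>

lemma lusin_measurable_sequence:
  fixes \<gamma> :: "nat \<Rightarrow> real \<Rightarrow> 'a::topological_space"
  assumes "\<And>n. lusin_measurable (\<gamma> n)" "\<epsilon> > 0"
  obtains K where "K \<subseteq> {0..1}" "compact K" "measure lebesgue ({0..1} - K) \<le> \<epsilon>"
    "\<And>n. continuous_on K (\<gamma> n)"
proof -
  have "\<epsilon> * (1/2) ^ Suc n > 0" for n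
    using \<open>\<epsilon> > 0\<close> by simp
  then have "\<exists>K\<subseteq>{0..1}. compact K \<and> measure lebesgue ({0..1} - K) \<le> \<epsilon> * (1/2) ^ Suc n \<and>
      continuous_on K (\<gamma> n)" for n
    using assms(1)[of n] unfolding lusin_measurable_def by blast
  then obtain K where K: "\<And>n. K n \<subseteq> {0..1}" "\<And>n. compact (K n)"
      "\<And>n. measure lebesgue ({0..1} - K n) \<le> \<epsilon> * (1/2) ^ Suc n"
      "\<And>n. continuous_on (K n) (\<gamma> n)"
    by metis
  have diff: "{0..1} - K n \<in> lmeasurable" for n
    by (intro fmeasurable.Diff lmeasurable_compact K(2)) auto
  show ?thesis
  proof
    show "(\<Inter>n. K n) \<subseteq> {0..1}"
      using K(1) by blast
    show "compact (\<Inter>n. K n)"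
      by (intro compact_Inter) (use K(2) in auto)
    show "continuous_on (\<Inter>n. K n) (\<gamma> n)" for n
      by (rule continuous_on_subset[OF K(4)[of n]]) auto
    have sums: "(\<lambda>n. \<epsilon> * (1/2) ^ Suc n) sums \<epsilon>"
      using sums_mult[OF power_half_series, of \<epsilon>] by simp
    have "measure lebesgue ({0..1} - (\<Inter>n. K n)) = measure lebesgue (\<Union>n. {0..1} - K n)"
      by (rule arg_cong[of _ _ "measure lebesgue"]) auto
    also have "\<dots> \<le> \<epsilon>"
    \<comment> \<open>It suffices to bound finite subunions, whose measures are at most partial sums
      of the geometric series.\<close>
    proof (rule measure_UN_bound)
      fix I :: "nat set"
      assume "finite I"
      have "(\<Sum>n\<in>I. measure lebesgue ({0..1} - K n)) \<le> (\<Sum>n\<in>I. \<epsilon> * (1/2) ^ Suc n)"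
        by (intro sum_mono K(3))
      also have "\<dots> \<le> (\<Sum>n. \<epsilon> * (1/2) ^ Suc n)"
        by (rule sum_le_suminf[OF sums_summable[OF sums] \<open>finite I\<close>]) (use \<open>\<epsilon> > 0\<close> in auto)
      also have "\<dots> = \<epsilon>"
        by (rule sums_unique[OF sums, symmetric])
      finally show "measure lebesgue (\<Union>n\<in>I. {0..1} - K n) \<le> \<epsilon>"
        using measure_UNION_le[OF \<open>finite I\<close> fmeasurableD[OF diff]] by (rule order_trans[rotated])
    qed (use diff in auto)
    finally show "measure lebesgue ({0..1} - (\<Inter>n. K n)) \<le> \<epsilon>" .
  qed
qed

text \<open>The points of \<open>S\<close> where \<open>P\<close> fails lie in every
  \<open>S - M\<close>, so they have outer measure zero. Measurability of this set is a conclusion,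
  by completeness of Lebesgue measure.\<close>

lemma AE_lebesgue_on_exhausted:
  assumes "\<And>\<epsilon>. \<epsilon> > 0 \<Longrightarrow>
    \<exists>M\<subseteq>S. M \<in> sets lebesgue \<and> measure lebesgue (S - M) < \<epsilon> \<and> (\<forall>t\<in>M. P t)"
    and "S \<in> lmeasurable"
  shows "AE t in lebesgue_on S. P t"
proof -
  have "\<exists>T. {t \<in> S. \<not> P t} \<subseteq> T \<and> T \<in> lmeasurable \<and> measure lebesgue T \<le> \<epsilon>" if "\<epsilon> > 0" for \<epsilon>
  proof -
    obtain M where "M \<subseteq> S" "M \<in> sets lebesgue" "measure lebesgue (S - M) < \<epsilon>" "\<forall>t\<in>M. P t"
      using assms(1)[OF \<open>\<epsilon> > 0\<close>] by blast
    with assms(2) show ?thesis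
      by (intro exI[of _ "S - M"]) (auto intro: fmeasurable_Diff)
  qed
  then have "negligible {t \<in> S. \<not> P t}"
    by (auto simp: negligible_outer_le)
  then have "{t \<in> S. \<not> P t} \<in> null_sets lebesgue"
    by (simp add: negligible_iff_null_sets)
  then have "AE t in lebesgue. t \<in> S \<longrightarrow> P t"
    by (auto dest: AE_not_in)
  with assms(2) show ?thesis
    by (simp add: AE_restrict_space_iff fmeasurableD)
qed

theorem lemma2p13:
  fixes \<gamma> :: "nat \<Rightarrow> real \<Rightarrow> 'a :: {locally_convex_space, t2_space}"
  assumes "sequentially_complete (UNIV :: 'a set)"
    and "\<And>n. lusin_measurable (\<gamma> n)"
    and "\<And>\<epsilon>::real. \<epsilon> > 0 \<Longrightarrow>
      \<exists>M\<subseteq>{0..1}. compact M \<and> measure lebesgue ({0..1} - M) < \<epsilon> \<and> uniformly_Cauchy_in M \<gamma>"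
  shows "(AE t in lebesgue_on {0..1}. convergent (\<lambda>n. \<gamma> n t)) \<and>
    lusin_measurable (\<lambda>t. if convergent (\<lambda>n. \<gamma> n t) then lim (\<lambda>n. \<gamma> n t) else 0)"
    (is "_ \<and> lusin_measurable ?g")
proof
  show "AE t in lebesgue_on {0..1}. convergent (\<lambda>n. \<gamma> n t)"
  proof (rule AE_lebesgue_on_exhausted)
    fix \<epsilon> :: real
    assume "\<epsilon> > 0"
    then obtain M where "M \<subseteq> {0..1}" "compact M" "measure lebesgue ({0..1} - M) < \<epsilon>"
        "uniformly_Cauchy_in M \<gamma>"
      using assms(3) by blast
    then show "\<exists>M\<subseteq>{0..1}. M \<in> sets lebesgue \<and> measure lebesgue ({0..1} - M) < \<epsilon> \<and>
        (\<forall>t\<in>M. convergent (\<lambda>n. \<gamma> n t))"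
      using uniformly_Cauchy_in_convergent[OF assms(1)] lmeasurable_compact fmeasurableD by metis
  qed auto
  show "lusin_measurable ?g"
    unfolding lusin_measurable_def
  proof (intro allI impI)
    fix \<epsilon> :: real
    assume "\<epsilon> > 0"
    \<comment> \<open>Half of \<epsilon> pays for uniform convergence on \<open>M\<close>, the other
      half for simultaneous continuity on \<open>K\<close>.\<close>
    then obtain M where M: "M \<subseteq> {0..1}" "compact M" "measure lebesgue ({0..1} - M) < \<epsilon> / 2"
        "uniformly_Cauchy_in M \<gamma>"
      using assms(3)[of "\<epsilon> / 2"] by auto
    obtain K where K: "K \<subseteq> {0..1}" "compact K" "measure lebesgue ({0..1} - K) \<le> \<epsilon> / 2"
        "\<And>n. continuous_on K (\<gamma> n)"
      using lusin_measurable_sequence[of \<gamma>, OF assms(2) half_gt_zero[OF \<open>\<epsilon> > 0\<close>]] by blast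
    \<comment> \<open>On \<open>M\<close> the sequence converges, so the default value 0 never
      occurs there; in a Hausdorff space \<open>lim\<close> is then its limit.\<close>
    have "(\<lambda>n. \<gamma> n t) \<longlonglongrightarrow> ?g t" if "t \<in> M" for t
      using uniformly_Cauchy_in_convergent[OF assms(1) M(4) that]
      by (simp add: convergent_LIMSEQ_iff)
    then have "continuous_on (M \<inter> K) ?g"
      by (rule uniformly_Cauchy_in_limit_continuous_on[OF M(4)])
        (auto intro: continuous_on_subset[OF K(4)])
    moreover have "measure lebesgue ({0..1} - M \<inter> K) \<le> \<epsilon>"
    proof -
      have "measure lebesgue ({0..1} - M \<inter> K) =
          measure lebesgue (({0..1} - M) \<union> ({0..1} - K))"
        by (simp add: Diff_Int)
      also have "\<dots> \<le> measure lebesgue ({0..1} - M) + measure lebesgue ({0..1} - K)"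
        by (intro measure_Un_le sets.Diff fmeasurableD[OF lmeasurable_compact] M(2) K(2)) auto
      finally show ?thesis
        using M(3) K(3) by simp
    qed
    ultimately show "\<exists>K\<subseteq>{0..1}. compact K \<and> measure lebesgue ({0..1} - K) \<le> \<epsilon> \<and>
        continuous_on K ?g"
      using M(1,2) K(2) by (intro exI[of _ "M \<inter> K"]) (auto intro: compact_Int)
  qed
qed

end
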